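(* Let $S$ be a strict complete stable marriage instance of size $n$ with rank-complement matrices $A,B$, let $S_m$ be a set of men and $S_w$ a set of women, and put $a=|S_m|$, $b=|S_w|$. If $A_{ij}\ge a$ and $B_{ij}\ge b$ for all $(i,j)\in S_m\times S_w$, then conditions (H1) and (H2) (defined in the context) hold for $(S_m,S_w)$, and therefore $\beta(S)\ge ab$.
   Context: In an instance $S$ of size $n$ there are $n$ men and $n$ women, each with a strict complete preference order on the other side; $r_M(i,j)\in\{1,\dots,n\}$ is the rank of woman $j$ in man $i$'s list and $r_W(j,i)\in\{1,\dots,n\}$ the rank of man $i$ in woman $j$'s list (1 is best). The rank-complement matrices are $A_{ij}=n-r_M(i,j)$ and $B_{ij}=n-r_W(j,i)$. A complete matching is a bijection $\mu$ from men to women; $(i,j)$ blocks $\mu$ if man $i$ strictly prefers woman $j$ to his partner under $\mu$ and woman $j$ strictly prefers man $i$ to her partner under $\mu$; $B_S(\mu)$ is the number of blocking pairs and $\beta(S)=\max_\mu B_S(\mu)$. Let $T_w$ be the set of women not in $S_w$ and $T_m$ the set of men not in $S_m$. The maximum over an empty set of ranks is read as $0$. (H1): the bipartite graph on $(S_m,T_w)$ with $i\sim w$ iff $r_M(i,w)>\max_{j\in S_w}r_M(i,j)$ has a matching saturating $S_m$. (H2): the bipartite graph on $(S_w,T_m)$ with $j\sim i'$ iff $r_W(j,i')>\max_{i\in S_m}r_W(j,i)$ has a matching saturating $S_w$. *)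

theory Defs
  imports Main
begin

text \<open>
  Preferences are strict linear orders: \<open>(x, y) \<in> r\<close> means that \<open>x\<close> is strictly
  preferred to \<open>y\<close>.  The library predicate \<open>strict_linear_order_on X r\<close> does not restrict
  \<open>r\<close> to \<open>X\<close>, hence the extra inclusion in \<open>strict_complete_pref\<close>.
\<close>

record ('m, 'w) sm_profile =
  men :: "'m set"
  women :: "'w set"
  man_pref :: "'m \<Rightarrow> 'w rel"
  woman_pref :: "'w \<Rightarrow> 'm rel"

definition strict_complete_pref :: "'a set \<Rightarrow> 'a rel \<Rightarrow> bool" where
  "strict_complete_pref X r \<longleftrightarrow> r \<subseteq> X \<times> X \<and> strict_linear_order_on X r"

definition sm_instance :: "nat \<Rightarrow> ('m, 'w) sm_profile \<Rightarrow> bool" where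
  "sm_instance n S \<longleftrightarrow>
     finite (men S) \<and> card (men S) = n \<and>
     finite (women S) \<and> card (women S) = n \<and>
     (\<forall>i \<in> men S. strict_complete_pref (women S) (man_pref S i)) \<and>
     (\<forall>j \<in> women S. strict_complete_pref (men S) (woman_pref S j))"

definition pref_rank :: "'a set \<Rightarrow> 'a rel \<Rightarrow> 'a \<Rightarrow> nat" where
  "pref_rank X r x = card {y \<in> X. (y, x) \<in> r} + 1"

definition rM :: "('m, 'w) sm_profile \<Rightarrow> 'm \<Rightarrow> 'w \<Rightarrow> nat" where
  "rM S i j = pref_rank (women S) (man_pref S i) j"

definition rW :: "('m, 'w) sm_profile \<Rightarrow> 'w \<Rightarrow> 'm \<Rightarrow> nat" where
  "rW S j i = pref_rank (men S) (woman_pref S j) i"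

text \<open>Both rank-complement matrices are indexed by (man, woman).\<close>

definition rank_complement_M :: "nat \<Rightarrow> ('m, 'w) sm_profile \<Rightarrow> 'm \<Rightarrow> 'w \<Rightarrow> int" where
  "rank_complement_M n S i j = int n - int (rM S i j)"

definition rank_complement_W :: "nat \<Rightarrow> ('m, 'w) sm_profile \<Rightarrow> 'm \<Rightarrow> 'w \<Rightarrow> int" where
  "rank_complement_W n S i j = int n - int (rW S j i)"

definition complete_matching :: "('m, 'w) sm_profile \<Rightarrow> ('m \<Rightarrow> 'w) \<Rightarrow> bool" where
  "complete_matching S \<mu> \<longleftrightarrow> bij_betw \<mu> (men S) (women S)"

definition blocking_pairs :: "('m, 'w) sm_profile \<Rightarrow> ('m \<Rightarrow> 'w) \<Rightarrow> ('m \<times> 'w) set" where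
  "blocking_pairs S \<mu> =
     {(i, j) \<in> men S \<times> women S.
        (j, \<mu> i) \<in> man_pref S i \<and> (i, inv_into (men S) \<mu> j) \<in> woman_pref S j}"

text \<open>
  For an instance, the set below is nonempty and bounded by \<open>n\<^sup>2\<close>, so \<open>Max\<close> is a true maximum.
\<close>

definition max_blocking :: "('m, 'w) sm_profile \<Rightarrow> nat" where
  "max_blocking S = Max {card (blocking_pairs S \<mu>) | \<mu>. complete_matching S \<mu>}"

definition max_rank :: "nat set \<Rightarrow> nat" where
  "max_rank R = (if R = {} then 0 else Max R)"

definition bipartite_edges :: "'a set \<Rightarrow> 'b set \<Rightarrow> ('a \<Rightarrow> 'b \<Rightarrow> bool) \<Rightarrow> ('a \<times> 'b) set" where
  "bipartite_edges X Y adj = {(x, y) \<in> X \<times> Y. adj x y}"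

definition bipartite_matching :: "('a \<times> 'b) set \<Rightarrow> ('a \<times> 'b) set \<Rightarrow> bool" where
  "bipartite_matching E N \<longleftrightarrow>
     N \<subseteq> E \<and> (\<forall>e \<in> N. \<forall>f \<in> N. e \<noteq> f \<longrightarrow> fst e \<noteq> fst f \<and> snd e \<noteq> snd f)"

definition has_saturating_matching ::
    "'a set \<Rightarrow> 'b set \<Rightarrow> ('a \<Rightarrow> 'b \<Rightarrow> bool) \<Rightarrow> bool" where
  "has_saturating_matching X Y adj \<longleftrightarrow>
     (\<exists>N. bipartite_matching (bipartite_edges X Y adj) N \<and> (\<forall>x \<in> X. \<exists>y. (x, y) \<in> N))"

definition H1 :: "('m, 'w) sm_profile \<Rightarrow> 'm set \<Rightarrow> 'w set \<Rightarrow> bool" where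
  "H1 S Sm Sw \<longleftrightarrow>
     has_saturating_matching Sm (women S - Sw)
       (\<lambda>i w. rM S i w > max_rank {rM S i j | j. j \<in> Sw})"

definition H2 :: "('m, 'w) sm_profile \<Rightarrow> 'm set \<Rightarrow> 'w set \<Rightarrow> bool" where
  "H2 S Sm Sw \<longleftrightarrow>
     has_saturating_matching Sw (men S - Sm)
       (\<lambda>j i'. rW S j i' > max_rank {rW S j i | i. i \<in> Sm})"

end

(* If every vertex of X has at least |X| neighbours, a matching saturating X can be chosen greedily.
   The hypothesis A_ij >= a says that man i ranks at least a women below all of S_w, so this gives
   (H1), and (H2) by symmetry. The two matchings then send S_m outside S_w and match S_w with men
   outside S_m; together they form a partial injection, and any extension of it to a complete
   matching is blocked by all of S_m x S_w. *)

theory Submission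
  imports Defs
begin

section \<open>Saturating matchings as injections, and how injections are chosen and
  extended\<close>

text \<open>Picking one edge at each vertex of \<open>X\<close> gives a function, and disjointness
  of the edges makes it injective; conversely its graph is a matching. Functions are easier to glue
  than edge sets.\<close>

lemma has_saturating_matching_iff_inj_on:
  "has_saturating_matching X Y adj \<longleftrightarrow>
     (\<exists>f. inj_on f X \<and> (\<forall>x \<in> X. f x \<in> Y \<and> adj x (f x)))"
proof
  assume "has_saturating_matching X Y adj"
  then obtain N where N: "bipartite_matching (bipartite_edges X Y adj) N"
    and "\<forall>x \<in> X. \<exists>y. (x, y) \<in> N"
    unfolding has_saturating_matching_def by blast
  then obtain f where f: "\<forall>x \<in> X. (x, f x) \<in> N"
    by metis
  have "inj_on f X"
  proof (rule inj_onI)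
    fix x x' assume "x \<in> X" "x' \<in> X" "f x = f x'"
    with f N show "x = x'"
      unfolding bipartite_matching_def by fastforce
  qed
  moreover have "\<forall>x \<in> X. f x \<in> Y \<and> adj x (f x)"
    using f N unfolding bipartite_matching_def bipartite_edges_def by blast
  ultimately show "\<exists>f. inj_on f X \<and> (\<forall>x \<in> X. f x \<in> Y \<and> adj x (f x))"
    by blast
next
  assume "\<exists>f. inj_on f X \<and> (\<forall>x \<in> X. f x \<in> Y \<and> adj x (f x))"
  then obtain f where f: "inj_on f X" "\<forall>x \<in> X. f x \<in> Y \<and> adj x (f x)"
    by blast
  let ?N = "(\<lambda>x. (x, f x)) ` X"
  have "bipartite_matching (bipartite_edges X Y adj) ?N"
    using f unfolding bipartite_matching_def bipartite_edges_def
    by (auto dest: inj_onD)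
  moreover have "\<forall>x \<in> X. \<exists>y. (x, y) \<in> ?N"
    by blast
  ultimately show "has_saturating_matching X Y adj"
    unfolding has_saturating_matching_def by blast
qed

text \<open>When \<open>a\<close> is added, the earlier choices occupy fewer than
  \<open>card (insert a X)\<close> elements, so \<open>N a\<close> still has a free one. No appeal
  to Hall's theorem is made.\<close>

lemma greedy_system_of_representatives:
  assumes "finite X" and "\<And>x. x \<in> X \<Longrightarrow> finite (N x) \<and> card X \<le> card (N x)"
  shows "\<exists>f. inj_on f X \<and> (\<forall>x \<in> X. f x \<in> N x)"
  using assms
proof (induction X rule: finite_induct)
  case empty
  then show ?case by simp
next
  case (insert a X)
  have "\<exists>f. inj_on f X \<and> (\<forall>x \<in> X. f x \<in> N x)"
    using insert.hyps insert.prems by (intro insert.IH) fastforce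
  then obtain f where f: "inj_on f X" "\<forall>x \<in> X. f x \<in> N x"
    by blast
  have "card (f ` X) < card (N a)"
    using insert.hyps insert.prems[of a] card_image_le[of X f] by simp
  then obtain y where y: "y \<in> N a" "y \<notin> f ` X"
    using insert.hyps card_mono[of "f ` X" "N a"] by (auto simp: not_le[symmetric])
  have "inj_on (f(a := y)) (insert a X)"
    using f(1) y(2) insert.hyps by (auto simp: inj_on_def)
  moreover have "\<forall>x \<in> insert a X. (f(a := y)) x \<in> N x"
    using f(2) y(1) insert.hyps by auto
  ultimately show ?case by blast
qed

lemma inj_on_extends_to_bij_betw:
  assumes "finite X" "finite Y" "card X = card Y"
    and "A \<subseteq> X" "inj_on h A" "h ` A \<subseteq> Y"
  shows "\<exists>\<mu>. bij_betw \<mu> X Y \<and> (\<forall>x \<in> A. \<mu> x = h x)"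
proof -
  have "card (X - A) = card (Y - h ` A)"
    using assms by (simp add: card_Diff_subset card_image finite_subset)
  then obtain g where g: "bij_betw g (X - A) (Y - h ` A)"
    using assms finite_same_card_bij[of "X - A" "Y - h ` A"] by blast
  let ?\<mu> = "\<lambda>x. if x \<in> A then h x else g x"
  have "bij_betw ?\<mu> A (h ` A)"
    using assms(5) by (simp add: bij_betw_def inj_on_def)
  moreover have "bij_betw ?\<mu> (X - A) (Y - h ` A)"
    using g by (subst bij_betw_cong[where g = g]) auto
  ultimately have "bij_betw ?\<mu> (A \<union> (X - A)) (h ` A \<union> (Y - h ` A))"
    by (rule bij_betw_combine) blast
  moreover have "A \<union> (X - A) = X" "h ` A \<union> (Y - h ` A) = Y"
    using assms by auto
  ultimately show ?thesis
    by (intro exI[of _ ?\<mu>]) simp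
qed

section \<open>Ranks in a strict order and the matchings they provide\<close>

text \<open>By transitivity everything preferred to \<open>x\<close> is preferred to
  \<open>y\<close>; \<open>x\<close> itself makes the inclusion strict, by irreflexivity.\<close>

lemma pref_rank_less:
  assumes "finite X" "strict_complete_pref X r" "(x, y) \<in> r"
  shows "pref_rank X r x < pref_rank X r y"
proof -
  have r: "trans r" "irrefl r" "x \<in> X"
    using assms by (auto simp: strict_complete_pref_def strict_linear_order_on_def)
  have "{z \<in> X. (z, x) \<in> r} \<subset> {z \<in> X. (z, y) \<in> r}"
    using r assms(3) by (auto simp: irrefl_def dest: transD)
  then have "card {z \<in> X. (z, x) \<in> r} < card {z \<in> X. (z, y) \<in> r}"
    using assms(1) by (intro psubset_card_mono) auto
  then show ?thesis by (simp add: pref_rank_def)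
qed

lemma pref_rank_less_iff:
  assumes "finite X" "strict_complete_pref X r" "x \<in> X" "y \<in> X"
  shows "pref_rank X r x < pref_rank X r y \<longleftrightarrow> (x, y) \<in> r"
proof
  assume less: "pref_rank X r x < pref_rank X r y"
  then have "x \<noteq> y" by blast
  moreover have "(y, x) \<notin> r"
    using pref_rank_less[OF assms(1,2)] less by (meson less_asym)
  ultimately show "(x, y) \<in> r"
    using assms
    by (auto simp: strict_complete_pref_def strict_linear_order_on_def total_on_def)
qed (rule pref_rank_less[OF assms(1,2)])

lemma inj_on_pref_rank:
  assumes "finite X" "strict_complete_pref X r"
  shows "inj_on (pref_rank X r) X"
proof (rule inj_onI)
  fix x y assume "x \<in> X" "y \<in> X" "pref_rank X r x = pref_rank X r y"
  then have "(x, y) \<notin> r" "(y, x) \<notin> r" "x \<in> X" "y \<in> X"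
    using pref_rank_less[OF assms] by fastforce+
  then show "x = y"
    using assms(2)
    by (auto simp: strict_complete_pref_def strict_linear_order_on_def total_on_def)
qed

text \<open>Ranks are distinct and positive, so at most \<open>k\<close> elements have rank at most
  \<open>k\<close>. The additive form avoids truncated subtraction.\<close>

lemma card_pref_rank_greater:
  assumes "finite X" "strict_complete_pref X r"
  shows "card X \<le> card {x \<in> X. k < pref_rank X r x} + k"
proof -
  let ?L = "{x \<in> X. pref_rank X r x \<le> k}"
  have "card ?L \<le> card {1..k}"
    using inj_on_pref_rank[OF assms]
    by (intro card_inj_on_le[of "pref_rank X r"])
      (auto simp: inj_on_def pref_rank_def)
  moreover have "X = {x \<in> X. k < pref_rank X r x} \<union> ?L"
    by auto
  then have "card X \<le> card {x \<in> X. k < pref_rank X r x} + card ?L"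
    using card_Un_le by metis
  ultimately show ?thesis by simp
qed

lemma le_max_rank:
  assumes "finite R" "k \<in> R"
  shows "k \<le> max_rank R"
  using assms by (auto simp: max_rank_def)

lemma max_rank_le:
  assumes "finite R" "\<And>k. k \<in> R \<Longrightarrow> k \<le> m"
  shows "max_rank R \<le> m"
  using assms by (auto simp: max_rank_def)

text \<open>One-sided form that yields both \<open>H1\<close> and \<open>H2\<close>. By
  \<open>room\<close> the largest rank in \<open>Q\<close> is at most
  \<open>card X - card P\<close>, so each member of \<open>P\<close> ranks at least
  \<open>card P\<close> elements beyond it, enough for the greedy choice. If \<open>Q\<close> is
  empty the threshold is 0 and every element of \<open>X\<close> qualifies;
  \<open>card P \<le> card X\<close> then gives the count.\<close>

lemma saturating_matching_if_low_ranks_large: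
  assumes "finite X" "finite P" "card P \<le> card X" "Q \<subseteq> X"
    and pref: "\<And>i. i \<in> P \<Longrightarrow> strict_complete_pref X (r i)"
    and room: "\<And>i j. i \<in> P \<Longrightarrow> j \<in> Q \<Longrightarrow> pref_rank X (r i) j + card P \<le> card X"
  shows "has_saturating_matching P (X - Q)
    (\<lambda>i w. pref_rank X (r i) w > max_rank {pref_rank X (r i) j | j. j \<in> Q})"
proof -
  let ?R = "\<lambda>i. {pref_rank X (r i) j | j. j \<in> Q}"
  let ?N = "\<lambda>i. {w \<in> X. max_rank (?R i) < pref_rank X (r i) w}"
  have fin: "finite (?R i)" for i
    using assms(1,4) by (simp add: finite_subset)
  have "finite (?N i) \<and> card P \<le> card (?N i)" if "i \<in> P" for i
  proof -
    have "max_rank (?R i) \<le> card X - card P"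
    proof (rule max_rank_le[OF fin])
      fix k assume "k \<in> ?R i"
      then show "k \<le> card X - card P"
        using room[OF that] by fastforce
    qed
    then show ?thesis
      using card_pref_rank_greater[OF assms(1) pref[OF that], of "max_rank (?R i)"] assms(1,3)
      by simp
  qed
  then obtain f where f: "inj_on f P" "\<forall>i \<in> P. f i \<in> ?N i"
    using greedy_system_of_representatives[OF assms(2), of ?N] by blast
  \<comment> \<open>The sets \<open>?N i\<close> are taken in all of \<open>X\<close>; exceeding the
    maximal rank in \<open>Q\<close> already forces the chosen element out of
    \<open>Q\<close>.\<close>
  moreover have "f i \<notin> Q" if "i \<in> P" for i
  proof
    assume "f i \<in> Q"
    then have "pref_rank X (r i) (f i) \<le> max_rank (?R i)"
      by (intro le_max_rank[OF fin]) blast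
    with f(2) that show False by fastforce
  qed
  ultimately show ?thesis
    unfolding has_saturating_matching_iff_inj_on by blast
qed

section \<open>From the two matchings to many blocking pairs\<close>

lemma max_blocking_ge:
  assumes "sm_instance n S" "complete_matching S \<mu>"
  shows "card (blocking_pairs S \<mu>) \<le> max_blocking S"
proof -
  have fin: "finite (men S \<times> women S)"
    using assms(1) by (simp add: sm_instance_def)
  have sub: "blocking_pairs S \<nu> \<subseteq> men S \<times> women S" for \<nu>
    by (auto simp: blocking_pairs_def)
  \<comment> \<open>\<open>Max\<close> bounds its elements only on a finite set; this uniform bound
    supplies finiteness.\<close>
  have "{card (blocking_pairs S \<nu>) | \<nu>. complete_matching S \<nu>} \<subseteq> {..card (men S \<times> women S)}"
    using card_mono[OF fin sub] by blast
  then have "finite {card (blocking_pairs S \<nu>) | \<nu>. complete_matching S \<nu>}"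
    by (rule finite_subset) simp
  then show ?thesis
    unfolding max_blocking_def using assms(2) by (intro Max_ge) auto
qed

text \<open>In the matching built here, \<open>i\<close> in \<open>Sm\<close> gets
  \<open>f i\<close>, whom he ranks below all of \<open>Sw\<close>, and \<open>j\<close> in
  \<open>Sw\<close> gets \<open>g j\<close>, whom she ranks below all of \<open>Sm\<close>. Hence
  each pair in \<open>Sm \<times> Sw\<close> blocks.\<close>

lemma max_blocking_ge_if_H1_H2:
  assumes inst: "sm_instance n S" and "Sm \<subseteq> men S" "Sw \<subseteq> women S"
    and "H1 S Sm Sw" "H2 S Sm Sw"
  shows "card Sm * card Sw \<le> max_blocking S"
proof -
  have fin: "finite (men S)" "finite (women S)" "card (men S) = card (women S)"
    and pref: "\<And>i. i \<in> men S \<Longrightarrow> strict_complete_pref (women S) (man_pref S i)"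
      "\<And>j. j \<in> women S \<Longrightarrow> strict_complete_pref (men S) (woman_pref S j)"
    using inst by (auto simp: sm_instance_def)
  have fin': "finite Sm" "finite Sw"
    using assms(2,3) fin by (auto intro: finite_subset)
  obtain f where f: "inj_on f Sm" "\<And>i. i \<in> Sm \<Longrightarrow> f i \<in> women S - Sw"
    and f_rank: "\<And>i. i \<in> Sm \<Longrightarrow> max_rank {rM S i j | j. j \<in> Sw} < rM S i (f i)"
    using assms(4) unfolding H1_def has_saturating_matching_iff_inj_on by blast
  obtain g where g: "inj_on g Sw" "\<And>j. j \<in> Sw \<Longrightarrow> g j \<in> men S - Sm"
    and g_rank: "\<And>j. j \<in> Sw \<Longrightarrow> max_rank {rW S j i | i. i \<in> Sm} < rW S j (g j)"
    using assms(5) unfolding H2_def has_saturating_matching_iff_inj_on by blast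
  \<comment> \<open>Since \<open>g\<close> goes from women to men, its inverse is what joins
    \<open>f\<close> in a map from men to women. The branches do not conflict, as \<open>g\<close>
    avoids \<open>Sm\<close>.\<close>
  define h where "h i = (if i \<in> Sm then f i else inv_into Sw g i)" for i
  have h_f: "h i = f i" if "i \<in> Sm" for i
    using that by (simp add: h_def)
  have h_g: "h (g j) = j" if "j \<in> Sw" for j
    using g that by (simp add: h_def)
  have "inj_on h (Sm \<union> g ` Sw)"
  proof (rule inj_onI)
    fix x y assume xy: "x \<in> Sm \<union> g ` Sw" "y \<in> Sm \<union> g ` Sw" "h x = h y"
    \<comment> \<open>Whether \<open>h x\<close> lies in \<open>Sw\<close> tells which branch
      produced it, so values from different branches cannot coincide.\<close>
    have *: "x \<in> Sm \<and> h x = f x \<and> h x \<notin> Sw \<or> (\<exists>j \<in> Sw. x = g j \<and> h x = j)"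
      if "x \<in> Sm \<union> g ` Sw" for x
      using that h_f[of x] h_g f(2)[of x] by auto
    show "x = y"
      using *[OF xy(1)] *[OF xy(2)] xy(3) f(1) by (metis inj_onD)
  qed
  moreover have "h ` (Sm \<union> g ` Sw) \<subseteq> women S"
  proof
    fix w assume "w \<in> h ` (Sm \<union> g ` Sw)"
    then consider i where "i \<in> Sm" "w = h i" | j where "j \<in> Sw" "w = h (g j)"
      by blast
    then show "w \<in> women S"
    proof cases
      case 1
      then show ?thesis using h_f f(2) by simp
    next
      case 2
      then show ?thesis using h_g assms(3) by auto
    qed
  qed
  moreover have "Sm \<union> g ` Sw \<subseteq> men S"
    using assms(2) g(2) by auto
  ultimately obtain \<mu> where \<mu>: "bij_betw \<mu> (men S) (women S)"
    and \<mu>_h: "\<forall>x \<in> Sm \<union> g ` Sw. \<mu> x = h x"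
    using inj_on_extends_to_bij_betw[OF fin, of "Sm \<union> g ` Sw" h] by blast
  have \<mu>_f: "\<mu> i = f i" if "i \<in> Sm" for i
    using \<mu>_h h_f that by simp
  \<comment> \<open>The partner of a woman enters \<open>blocking_pairs\<close> through
    \<open>inv_into\<close>, so it has to be identified with \<open>g j\<close>.\<close>
  have \<mu>_g: "inv_into (men S) \<mu> j = g j" if "j \<in> Sw" for j
  proof (rule inv_into_f_eq)
    show "inj_on \<mu> (men S)" using \<mu> by (rule bij_betw_imp_inj_on)
    show "g j \<in> men S" using g(2) that by blast
    show "\<mu> (g j) = j" using \<mu>_h h_g that by auto
  qed
  have "Sm \<times> Sw \<subseteq> blocking_pairs S \<mu>"
  proof (rule subrelI)
    fix i j assume "(i, j) \<in> Sm \<times> Sw"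
    then have ij: "i \<in> Sm" "j \<in> Sw" "i \<in> men S" "j \<in> women S"
      using assms(2,3) by auto
    have "rM S i j \<le> max_rank {rM S i j | j. j \<in> Sw}"
      using ij fin' by (intro le_max_rank) auto
    then have "rM S i j < rM S i (f i)"
      using f_rank[OF ij(1)] by linarith
    then have "(j, f i) \<in> man_pref S i"
      using pref_rank_less_iff[OF fin(2) pref(1)] ij f(2) by (auto simp: rM_def)
    moreover have "rW S j i \<le> max_rank {rW S j i | i. i \<in> Sm}"
      using ij fin' by (intro le_max_rank) auto
    then have "rW S j i < rW S j (g j)"
      using g_rank[OF ij(2)] by linarith
    then have "(i, g j) \<in> woman_pref S j"
      using pref_rank_less_iff[OF fin(1) pref(2)] ij g(2) by (auto simp: rW_def)
    ultimately show "(i, j) \<in> blocking_pairs S \<mu>"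
      using ij \<mu>_f \<mu>_g by (simp add: blocking_pairs_def)
  qed
  moreover have "finite (blocking_pairs S \<mu>)"
    by (rule finite_subset[of _ "men S \<times> women S"]) (use fin in \<open>auto simp: blocking_pairs_def\<close>)
  ultimately have "card (Sm \<times> Sw) \<le> card (blocking_pairs S \<mu>)"
    by (intro card_mono)
  also have "\<dots> \<le> max_blocking S"
    using \<mu> by (intro max_blocking_ge[OF inst]) (simp add: complete_matching_def)
  finally show ?thesis
    by (simp add: card_cartesian_product)
qed

theorem lemma6p4:
  fixes S :: "('m, 'w) sm_profile"
    and n a b :: nat
    and Sm :: "'m set"
    and Sw :: "'w set"
  assumes "sm_instance n S"
    and "Sm \<subseteq> men S"
    and "Sw \<subseteq> women S"
    and "a = card Sm"
    and "b = card Sw"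
    and "\<forall>i \<in> Sm. \<forall>j \<in> Sw.
           rank_complement_M n S i j \<ge> int a \<and> rank_complement_W n S i j \<ge> int b"
  shows "H1 S Sm Sw \<and> H2 S Sm Sw \<and> max_blocking S \<ge> a * b"
proof -
  have fin: "finite (men S)" "card (men S) = n" "finite (women S)" "card (women S) = n"
    and pref: "\<And>i. i \<in> men S \<Longrightarrow> strict_complete_pref (women S) (man_pref S i)"
      "\<And>j. j \<in> women S \<Longrightarrow> strict_complete_pref (men S) (woman_pref S j)"
    using assms(1) by (auto simp: sm_instance_def)
  \<comment> \<open>These bounds do not follow from the matrix hypothesis when the opposite set is
    empty, since it is then vacuous.\<close>
  have card_le: "card Sm \<le> n" "card Sw \<le> n"
    using assms(2,3) fin card_mono by metis+
  \<comment> \<open>The integer matrix bounds become additive inequalities over the naturals, the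
    form required by the one-sided lemma.\<close>
  have room: "rM S i j + card Sm \<le> n \<and> rW S j i + card Sw \<le> n" if "i \<in> Sm" "j \<in> Sw" for i j
    using assms(4-6) that
    by (fastforce simp: rank_complement_M_def rank_complement_W_def)
  have "H1 S Sm Sw"
    unfolding H1_def rM_def
    using fin pref card_le room assms(2,3)
    by (intro saturating_matching_if_low_ranks_large)
      (auto simp: rM_def intro: finite_subset)
  \<comment> \<open>Here the roles are exchanged: \<open>Sw\<close> chooses among the men, and
    \<open>Sm\<close> is the set to be avoided.\<close>
  moreover have "H2 S Sm Sw"
    unfolding H2_def rW_def
    using fin pref card_le room assms(2,3)
    by (intro saturating_matching_if_low_ranks_large)
      (auto simp: rW_def intro: finite_subset)
  ultimately show ?thesis
    using max_blocking_ge_if_H1_H2[OF assms(1-3)] assms(4,5) by blast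
qed

end
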